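(* Let $(X,\mathcal{A},\lambda)$ be a $\sigma$-finite measure space, $T:X\to X$ a null-preserving map, and $\mathfrak{S}=(X,\mathcal{A},\lambda,T)$. Then the following two properties are equivalent: (i) every tail set is invariant; (ii) for every $A\in\mathcal{A}$, the sets $A$ and $\hat{T}A$ remain separated if and only if $A\overset{.}{=}\varnothing$. As a consequence, $\mathfrak{S}$ is exact if and only if $\mathfrak{S}$ is ergodic and, for all $A\in\mathcal{A}$, $A$ remains separated from $\hat{T}A$ if and only if $A\overset{.}{=}\varnothing$.
   Context: For $A,B\in\mathcal{A}$ write $A\overset{.}{\subseteq}B$ if $\lambda(A\setminus B)=0$ and $A\overset{.}{=}B$ if $\lambda(A\triangle B)=0$. A measurable map $T:X\to X$ is null-preserving if $\lambda(A)=0$ implies $\lambda(T^{-1}A)=0$ for $A\in\mathcal{A}$. An essential image of $A\in\mathcal{A}$ under $T$ is a set $A'\in\mathcal{A}$ such that $T^{-1}A'\overset{.}{\supseteq}A$ and such that every $B'\in\mathcal{A}$ with $T^{-1}B'\overset{.}{\supseteq}A$ satisfies $B'\overset{.}{\supseteq}A'$. In the present ($\sigma$-finite, null-preserving) setting every $A\in\mathcal{A}$ has essential images and they form exactly one equivalence class under $\overset{.}{=}$; $\hat{T}A$ denotes an arbitrary fixed essential image of $A$. A tail set is a set $A\in\mathcal{A}$ with $A\overset{.}{=}B$ for some $B\in\bigcap_{n\ge0}T^{-n}\mathcal{A}$; $\mathfrak{S}$ is exact if every tail set $A$ satisfies $\lambda(A)=0$ or $\lambda(A^c)=0$. A set $A\in\mathcal{A}$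 is invariant if $A\overset{.}{=}T^{-1}A$; $\mathfrak{S}$ is ergodic if every invariant set $A$ satisfies $\lambda(A)=0$ or $\lambda(A^c)=0$. Sets $A,B\in\mathcal{A}$ remain separated if for every $n\ge0$ there is $A_n\in\mathcal{A}$ with $A\overset{.}{\subseteq}T^{-n}A_n$ and $B\overset{.}{\subseteq}T^{-n}A_n^c$. *)

theory Defs
  imports "HOL-Analysis.Analysis"
begin

text \<open>Since \<^const>\<open>null_sets\<close> consists of measurable sets only, the two relations below
  have their intended meaning on measurable sets, which is where they are used.\<close>

definition ess_subset :: "'a measure \<Rightarrow> 'a set \<Rightarrow> 'a set \<Rightarrow> bool" where
  "ess_subset M A B \<longleftrightarrow> A - B \<in> null_sets M"

definition ess_eq :: "'a measure \<Rightarrow> 'a set \<Rightarrow> 'a set \<Rightarrow> bool" where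
  "ess_eq M A B \<longleftrightarrow> sym_diff A B \<in> null_sets M"

definition preimage :: "'a measure \<Rightarrow> ('a \<Rightarrow> 'a) \<Rightarrow> nat \<Rightarrow> 'a set \<Rightarrow> 'a set" where
  "preimage M T n A = (T ^^ n) -` A \<inter> space M"

definition null_preserving :: "'a measure \<Rightarrow> ('a \<Rightarrow> 'a) \<Rightarrow> bool" where
  "null_preserving M T \<longleftrightarrow> T \<in> measurable M M \<and>
     (\<forall>A\<in>sets M. emeasure M A = 0 \<longrightarrow> emeasure M (preimage M T 1 A) = 0)"

definition essential_image :: "'a measure \<Rightarrow> ('a \<Rightarrow> 'a) \<Rightarrow> 'a set \<Rightarrow> 'a set \<Rightarrow> bool" where
  "essential_image M T A A' \<longleftrightarrow> A' \<in> sets M \<and> ess_subset M A (preimage M T 1 A') \<and>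
     (\<forall>B'\<in>sets M. ess_subset M A (preimage M T 1 B') \<longrightarrow> ess_subset M A' B')"

definition tail_set :: "'a measure \<Rightarrow> ('a \<Rightarrow> 'a) \<Rightarrow> 'a set \<Rightarrow> bool" where
  "tail_set M T A \<longleftrightarrow> A \<in> sets M \<and>
     (\<exists>B \<in> (\<Inter>n. preimage M T n ` sets M). ess_eq M A B)"

definition exact :: "'a measure \<Rightarrow> ('a \<Rightarrow> 'a) \<Rightarrow> bool" where
  "exact M T \<longleftrightarrow>
     (\<forall>A. tail_set M T A \<longrightarrow> emeasure M A = 0 \<or> emeasure M (space M - A) = 0)"

definition invariant_set :: "'a measure \<Rightarrow> ('a \<Rightarrow> 'a) \<Rightarrow> 'a set \<Rightarrow> bool" where
  "invariant_set M T A \<longleftrightarrow> A \<in> sets M \<and> ess_eq M A (preimage M T 1 A)"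

definition ergodic :: "'a measure \<Rightarrow> ('a \<Rightarrow> 'a) \<Rightarrow> bool" where
  "ergodic M T \<longleftrightarrow>
     (\<forall>A. invariant_set M T A \<longrightarrow> emeasure M A = 0 \<or> emeasure M (space M - A) = 0)"

definition remain_separated :: "'a measure \<Rightarrow> ('a \<Rightarrow> 'a) \<Rightarrow> 'a set \<Rightarrow> 'a set \<Rightarrow> bool" where
  "remain_separated M T A B \<longleftrightarrow> A \<in> sets M \<and> B \<in> sets M \<and>
     (\<forall>n. \<exists>C\<in>sets M. ess_subset M A (preimage M T n C) \<and>
                      ess_subset M B (preimage M T n (space M - C)))"

text \<open>Essential images exist and are unique up to null sets; in particular there are functions
  selecting an essential image of every measurable set.\<close>

lemma essential_image_exists:
  assumes "sigma_finite_measure M" and "null_preserving M T" and A: "A \<in> sets M"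
  shows "\<exists>A'. essential_image M T A A'"
proof -
  interpret sigma_finite_measure M by fact
  have T[measurable]: "T \<in> measurable M M"
    using assms(2) by (simp add: null_preserving_def)
  note A[measurable]
  define N where "N = distr (density M (indicator A)) M T"
  have T': "T \<in> measurable (density M (indicator A)) M"
    by simp
  have N: "emeasure N B = emeasure M (A \<inter> preimage M T 1 B)" if [measurable]: "B \<in> sets M" for B
  proof -
    have pre: "T -` B \<inter> space M \<in> sets M" by measurable
    have "emeasure N B = emeasure (density M (indicator A)) (T -` B \<inter> space M)"
      unfolding N_def using emeasure_distr[OF T' that] by simp
    also have "\<dots> = (\<integral>\<^sup>+x. indicator A x * indicator (T -` B \<inter> space M) x \<partial>M)"
      using pre by (subst emeasure_density) auto
    also have "\<dots> = (\<integral>\<^sup>+x. indicator (A \<inter> (T -` B \<inter> space M)) x \<partial>M)"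
      by (intro nn_integral_cong) (auto simp: indicator_def)
    also have "\<dots> = emeasure M (A \<inter> (T -` B \<inter> space M))"
      using pre by (intro nn_integral_indicator) auto
    finally show ?thesis by (simp add: preimage_def)
  qed
  have pre_sets: "preimage M T 1 B \<in> sets M" if "B \<in> sets M" for B
    using measurable_sets[OF T that] by (simp add: preimage_def)
  have setsN: "sets N = sets M" by (simp add: N_def)
  have "absolutely_continuous M N"
    unfolding absolutely_continuous_def
  proof
    fix B assume B: "B \<in> null_sets M"
    then have Bs: "B \<in> sets M" by auto
    have "emeasure M (preimage M T 1 B) = 0"
      using assms(2) B Bs by (auto simp: null_preserving_def)
    then have "emeasure M (A \<inter> preimage M T 1 B) = 0"
      using emeasure_mono[of "A \<inter> preimage M T 1 B" "preimage M T 1 B" M] pre_sets[OF Bs]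
      by simp
    then show "B \<in> null_sets N" using N[OF Bs] Bs setsN by auto
  qed
  then obtain f where f[measurable]: "f \<in> borel_measurable M" and dens: "density M f = N"
    using Radon_Nikodym[of N] setsN by blast
  define A' where "A' = {x \<in> space M. f x \<noteq> 0}"
  have A'[measurable]: "A' \<in> sets M" unfolding A'_def by measurable
  have key: "ess_subset M A (preimage M T 1 B) \<longleftrightarrow> ess_subset M A' B"
    if B: "B \<in> sets M" for B
  proof -
    note B[measurable]
    have eq: "A - preimage M T 1 B = A \<inter> preimage M T 1 (space M - B)"
      using sets.sets_into_space[OF A] measurable_space[OF T] by (auto simp: preimage_def)
    have "ess_subset M A (preimage M T 1 B) \<longleftrightarrow> emeasure N (space M - B) = 0"
      using A pre_sets[OF B] pre_sets[of "space M - B"] N[of "space M - B"] eq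
      by (auto simp: ess_subset_def null_sets_def)
    also have "\<dots> \<longleftrightarrow> (\<integral>\<^sup>+x. f x * indicator (space M - B) x \<partial>M) = 0"
      unfolding dens[symmetric] by (simp add: emeasure_density)
    also have "\<dots> \<longleftrightarrow> (AE x in M. x \<notin> A' - B)"
      by (subst nn_integral_0_iff_AE, simp, intro AE_cong) (auto simp: A'_def indicator_def)
    also have "\<dots> \<longleftrightarrow> A' - B \<in> null_sets M"
      by (intro AE_iff_null_sets[symmetric]) auto
    finally show ?thesis by (simp add: ess_subset_def)
  qed
  have "ess_subset M A' A'" by (simp add: ess_subset_def)
  then have "essential_image M T A A'"
    using A' key by (auto simp: essential_image_def)
  then show ?thesis ..
qed

lemma essential_image_unique:
  assumes "essential_image M T A A'" and "essential_image M T A A''"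
  shows "ess_eq M A' A''"
  using assms by (auto simp: essential_image_def ess_eq_def ess_subset_def)

lemma essential_image_choice_exists:
  assumes "sigma_finite_measure M" and "null_preserving M T"
  shows "\<exists>That. \<forall>A\<in>sets M. essential_image M T A (That A)"
  using essential_image_exists[OF assms] by (intro bchoice) blast

end

theory Submission
  imports Defs
begin

text \<open>Two sets \<open>A\<close>, \<open>B\<close> remain separated if and only if some tail set \<open>S\<close> contains \<open>A\<close> and is
  disjoint from \<open>B\<close>, up to null sets: if \<open>C\<^sub>n\<close> separates at time \<open>n\<close>, take
  \<open>S = limsup T\<^sup>-\<^sup>n C\<^sub>n\<close>, which lies in every \<open>T\<^sup>-\<^sup>n \<A>\<close>. The essential image \<open>A'\<close> of \<open>A\<close> is
  characterised by the adjunction \<open>A \<subseteq> T\<^sup>-\<^sup>1 B \<longleftrightarrow> A' \<subseteq> B\<close>. If \<open>S\<close> is invariant and separates \<open>A\<close> from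
  \<open>A'\<close>, then \<open>A \<subseteq> S = T\<^sup>-\<^sup>1 S\<close> puts \<open>A'\<close> inside \<open>S\<close>, so \<open>A'\<close> is null, and hence \<open>A\<close> is null.
  Conversely, a tail set \<open>S\<close> separates \<open>S - T\<^sup>-\<^sup>1 S\<close> from its essential image; if this forces the
  difference to be null for \<open>S\<close> and for its complement, then \<open>S\<close> is invariant.\<close>

subsection \<open>Inclusion and separation up to null sets\<close>

lemma ess_subset_iff_AE:
  assumes "A \<in> sets M" "B \<in> sets M"
  shows "ess_subset M A B \<longleftrightarrow> (AE x in M. x \<in> A \<longrightarrow> x \<in> B)"
  using AE_iff_null_sets[of "A - B" M] assms by (simp add: ess_subset_def)

lemma ess_subset_if_subset: "A \<subseteq> B \<Longrightarrow> ess_subset M A B"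
  by (simp add: ess_subset_def Diff_eq_empty_iff[THEN iffD2])

lemma ess_subset_trans:
  assumes "ess_subset M A B" "ess_subset M B C" "A \<in> sets M" "C \<in> sets M"
  shows "ess_subset M A C"
proof -
  have "(A - B) \<union> (B - C) \<in> null_sets M"
    using assms(1,2) by (auto simp: ess_subset_def)
  then show ?thesis
    unfolding ess_subset_def using assms(3,4) by (auto intro: null_sets_subset)
qed

lemma ess_subset_compl_iff:
  assumes "B \<in> sets M"
  shows "ess_subset M (space M - A) (space M - B) \<longleftrightarrow> ess_subset M B A"
proof -
  have "(space M - A) - (space M - B) = B - A"
    using sets.sets_into_space[OF assms] by blast
  then show ?thesis by (simp add: ess_subset_def)
qed

lemma null_set_if_ess_subset_compl:
  assumes "ess_subset M A B" "ess_subset M A (space M - B)" "A \<in> sets M"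
  shows "A \<in> null_sets M"
proof -
  have "A = (A - B) \<union> (A - (space M - B))"
    using sets.sets_into_space[OF assms(3)] by blast
  then show ?thesis
    using assms(1,2) null_sets.Un unfolding ess_subset_def by metis
qed

lemma ess_eq_iff_ess_subset:
  assumes "A \<in> sets M" "B \<in> sets M"
  shows "ess_eq M A B \<longleftrightarrow> ess_subset M A B \<and> ess_subset M B A"
proof
  assume "ess_eq M A B"
  then have "sym_diff A B \<in> null_sets M"
    by (simp add: ess_eq_def)
  then have "D \<in> null_sets M" if "D \<in> sets M" "D \<subseteq> sym_diff A B" for D
    using that by (rule null_sets_subset)
  with assms show "ess_subset M A B \<and> ess_subset M B A"
    by (simp add: ess_subset_def)
qed (auto simp: ess_eq_def ess_subset_def)

lemma ess_eq_empty_iff: "ess_eq M A {} \<longleftrightarrow> A \<in> null_sets M"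
  by (simp add: ess_eq_def)

lemma ess_eq_trans:
  assumes "ess_eq M A B" "ess_eq M B C" "A \<in> sets M" "B \<in> sets M" "C \<in> sets M"
  shows "ess_eq M A C"
  using assms ess_subset_trans unfolding ess_eq_iff_ess_subset[OF assms(3,4)]
    ess_eq_iff_ess_subset[OF assms(4,5)] ess_eq_iff_ess_subset[OF assms(3,5)] by blast

definition separates :: "'a measure \<Rightarrow> 'a set \<Rightarrow> 'a set \<Rightarrow> 'a set \<Rightarrow> bool" where
  "separates M S A B \<longleftrightarrow> ess_subset M A S \<and> ess_subset M B (space M - S)"

lemma separates_compl_iff:
  assumes "S \<in> sets M"
  shows "separates M (space M - S) B A \<longleftrightarrow> separates M S A B"
  using sets.sets_into_space[OF assms] by (auto simp: separates_def double_diff)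

lemma separates_from_compl_iff_ess_eq:
  assumes "A \<in> sets M" "S \<in> sets M"
  shows "separates M S A (space M - A) \<longleftrightarrow> ess_eq M A S"
  using assms by (simp add: separates_def ess_subset_compl_iff ess_eq_iff_ess_subset)

lemma separates_ess_eq:
  assumes "separates M S A B" "ess_eq M S S'"
    and "A \<in> sets M" "B \<in> sets M" "S \<in> sets M" "S' \<in> sets M"
  shows "separates M S' A B"
proof -
  have "ess_subset M S S'" "ess_subset M (space M - S) (space M - S')"
    using assms by (simp_all add: ess_eq_iff_ess_subset ess_subset_compl_iff)
  then show ?thesis
    using assms unfolding separates_def by (blast intro: ess_subset_trans sets.compl_sets)
qed

lemma separates_iff_AE:
  assumes "S \<in> sets M" "A \<in> sets M" "B \<in> sets M"
  shows "separates M S A B \<longleftrightarrow> (AE x in M. (x \<in> A \<longrightarrow> x \<in> S) \<and> (x \<in> B \<longrightarrow> x \<notin> S))"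
proof -
  have "separates M S A B \<longleftrightarrow> (AE x in M. (x \<in> A \<longrightarrow> x \<in> S) \<and> (x \<in> B \<longrightarrow> x \<in> space M - S))"
    using assms by (simp add: separates_def ess_subset_iff_AE)
  also have "\<dots> \<longleftrightarrow> (AE x in M. (x \<in> A \<longrightarrow> x \<in> S) \<and> (x \<in> B \<longrightarrow> x \<notin> S))"
    by (intro AE_cong) auto
  finally show ?thesis .
qed

subsection \<open>Tail sets and sets that remain separated\<close>

locale measurable_system =
  fixes M :: "'a measure" and T :: "'a \<Rightarrow> 'a"
  assumes measurable_T [measurable]: "T \<in> measurable M M"
begin

lemma funpow_in_space: "x \<in> space M \<Longrightarrow> (T ^^ n) x \<in> space M"
  using measurable_space[OF measurable_compose_n[OF measurable_T]] .

lemma sets_preimage [measurable, simp]: "A \<in> sets M \<Longrightarrow> preimage M T n A \<in> sets M"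
  unfolding preimage_def by measurable

lemma preimage_compl: "preimage M T n (space M - A) = space M - preimage M T n A"
  using funpow_in_space by (auto simp: preimage_def)

lemma preimage_add: "preimage M T (m + n) A = preimage M T n (preimage M T m A)"
  using funpow_in_space by (auto simp: preimage_def funpow_add)

definition limsup_preimages :: "(nat \<Rightarrow> 'a set) \<Rightarrow> 'a set" where
  "limsup_preimages C = {x \<in> space M. \<exists>\<^sub>F n in sequentially. (T ^^ n) x \<in> C n}"

lemma sets_limsup_preimages [measurable, simp]:
  assumes [measurable]: "\<And>n. C n \<in> sets M"
  shows "limsup_preimages C \<in> sets M"
  unfolding limsup_preimages_def frequently_def by measurable

lemma limsup_preimages_shift:
  "limsup_preimages C = preimage M T k (limsup_preimages (\<lambda>n. C (n + k)))"
proof -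
  have "(\<exists>\<^sub>F n in sequentially. (T ^^ n) x \<in> C n) \<longleftrightarrow>
      (\<exists>\<^sub>F n in sequentially. (T ^^ n) ((T ^^ k) x) \<in> C (n + k))" for x
    using eventually_sequentially_seg[of "\<lambda>n. (T ^^ n) x \<notin> C n" k]
    by (simp add: frequently_def funpow_add)
  then show ?thesis
    using funpow_in_space by (auto simp: limsup_preimages_def preimage_def)
qed

lemma tail_setE:
  assumes "tail_set M T A"
  obtains B where "A \<in> sets M" "B \<in> sets M" "ess_eq M A B" "\<And>n. B \<in> preimage M T n ` sets M"
proof -
  obtain B where B: "B \<in> (\<Inter>n. preimage M T n ` sets M)" "ess_eq M A B"
    using assms by (auto simp only: tail_set_def)
  have preimages: "B \<in> preimage M T n ` sets M" for n
    using B(1) by (rule INT_D) simp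
  have "B \<in> sets M"
    using preimages[of 0] by auto
  then show thesis
    using that assms B(2) preimages by (simp add: tail_set_def)
qed

lemma tail_set_limsup_preimages:
  assumes C: "\<And>n. C n \<in> sets M"
  shows "tail_set M T (limsup_preimages C)"
proof -
  have "limsup_preimages C \<in> preimage M T k ` sets M" for k
    using limsup_preimages_shift by (rule image_eqI) (simp add: C)
  moreover have "ess_eq M (limsup_preimages C) (limsup_preimages C)"
    by (simp add: ess_eq_def)
  ultimately show ?thesis
    unfolding tail_set_def using C by (intro conjI bexI INT_I) simp_all
qed

lemma separates_limsup_preimages:
  assumes sep: "\<And>n. separates M (preimage M T n (C n)) A B"
    and sets: "\<And>n. C n \<in> sets M" "A \<in> sets M" "B \<in> sets M"
  shows "separates M (limsup_preimages C) A B"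
proof -
  have "AE x in M. \<forall>n. (x \<in> A \<longrightarrow> x \<in> preimage M T n (C n)) \<and>
                       (x \<in> B \<longrightarrow> x \<notin> preimage M T n (C n))"
    unfolding AE_all_countable using sep sets by (simp add: separates_iff_AE)
  with AE_space have "AE x in M. (x \<in> A \<longrightarrow> x \<in> limsup_preimages C) \<and>
                                 (x \<in> B \<longrightarrow> x \<notin> limsup_preimages C)"
    by eventually_elim (auto simp: preimage_def limsup_preimages_def)
  then show ?thesis
    using sets by (simp add: separates_iff_AE)
qed

lemma remain_separated_iff_separates:
  "remain_separated M T A B \<longleftrightarrow> A \<in> sets M \<and> B \<in> sets M \<and>
    (\<forall>n. \<exists>C\<in>sets M. separates M (preimage M T n C) A B)"
  by (simp add: remain_separated_def separates_def preimage_compl)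

lemma remain_separated_commute: "remain_separated M T A B \<longleftrightarrow> remain_separated M T B A"
proof -
  have "remain_separated M T B A" if AB: "remain_separated M T A B" for A B
    unfolding remain_separated_iff_separates
  proof (intro conjI allI)
    fix n
    obtain C where C: "C \<in> sets M" "separates M (preimage M T n C) A B"
      using AB by (auto simp: remain_separated_iff_separates)
    then have "separates M (preimage M T n (space M - C)) B A"
      by (simp add: preimage_compl separates_compl_iff)
    with C(1) show "\<exists>D\<in>sets M. separates M (preimage M T n D) B A"
      by blast
  qed (use AB in \<open>simp_all add: remain_separated_def\<close>)
  then show ?thesis by blast
qed

lemma remain_separated_null_set:
  assumes A: "A \<in> null_sets M" and B: "B \<in> sets M"
  shows "remain_separated M T A B"
proof -
  have "ess_subset M A {}" "ess_subset M B (space M)"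
    using A sets.sets_into_space[OF B] by (simp add: ess_subset_def, intro ess_subset_if_subset)
  then have "separates M (preimage M T n {}) A B" for n
    by (simp add: separates_def preimage_def)
  then show ?thesis
    using A B by (auto simp: remain_separated_iff_separates)
qed

lemma remain_separated_iff_tail_set:
  assumes sets: "A \<in> sets M" "B \<in> sets M"
  shows "remain_separated M T A B \<longleftrightarrow> (\<exists>S. tail_set M T S \<and> separates M S A B)"
proof
  assume "remain_separated M T A B"
  then obtain C where "\<And>n. C n \<in> sets M" "\<And>n. separates M (preimage M T n (C n)) A B"
    unfolding remain_separated_iff_separates by metis
  with sets show "\<exists>S. tail_set M T S \<and> separates M S A B"
    using tail_set_limsup_preimages separates_limsup_preimages by blast
next
  assume "\<exists>S. tail_set M T S \<and> separates M S A B"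
  then obtain S where S: "tail_set M T S" "separates M S A B"
    by blast
  obtain S' where S': "S \<in> sets M" "S' \<in> sets M" "ess_eq M S S'"
      "\<And>n. S' \<in> preimage M T n ` sets M"
    using S(1) by (rule tail_setE) blast
  then have "separates M S' A B"
    using separates_ess_eq[OF S(2)] sets by simp
  then have "\<exists>C\<in>sets M. separates M (preimage M T n C) A B" for n
    using S'(4)[of n] by auto
  with sets show "remain_separated M T A B"
    by (simp add: remain_separated_iff_separates)
qed

lemma tail_set_iff_remain_separated_compl:
  assumes A: "A \<in> sets M"
  shows "tail_set M T A \<longleftrightarrow> remain_separated M T A (space M - A)"
proof
  assume "tail_set M T A"
  moreover have "separates M A A (space M - A)"
    by (simp add: separates_def ess_subset_if_subset)
  ultimately show "remain_separated M T A (space M - A)"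
    using A by (auto simp: remain_separated_iff_tail_set)
next
  assume "remain_separated M T A (space M - A)"
  then obtain S where S: "tail_set M T S" "separates M S A (space M - A)"
    using A by (auto simp: remain_separated_iff_tail_set)
  obtain S' where S': "S \<in> sets M" "S' \<in> sets M" "ess_eq M S S'"
      "\<And>n. S' \<in> preimage M T n ` sets M"
    using S(1) by (rule tail_setE) blast
  have "ess_eq M A S"
    using A S S' by (simp add: separates_from_compl_iff_ess_eq)
  then have "ess_eq M A S'"
    using ess_eq_trans S'(3) A S'(1,2) by blast
  with A S'(4) show "tail_set M T A"
    unfolding tail_set_def by blast
qed

lemma tail_set_compl:
  assumes "tail_set M T S"
  shows "tail_set M T (space M - S)"
proof -
  have S: "S \<in> sets M"
    using assms by (simp add: tail_set_def)
  have "remain_separated M T (space M - S) S"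
    using assms S remain_separated_commute by (simp add: tail_set_iff_remain_separated_compl)
  with S show ?thesis
    by (simp add: tail_set_iff_remain_separated_compl double_diff sets.sets_into_space)
qed

lemma invariant_set_compl:
  assumes "invariant_set M T A"
  shows "invariant_set M T (space M - A)"
  using assms by (auto simp: invariant_set_def ess_eq_iff_ess_subset preimage_compl
      ess_subset_compl_iff)

lemma remain_separated_tail_set_diff_preimage:
  assumes S: "tail_set M T S"
    and A': "essential_image M T (S - preimage M T 1 S) A'"
  shows "remain_separated M T (S - preimage M T 1 S) A'"
proof -
  let ?A = "S - preimage M T 1 S"
  have sets: "S \<in> sets M" "?A \<in> sets M" "A' \<in> sets M"
    using S A' by (auto simp: tail_set_def essential_image_def)
  have "?A \<subseteq> preimage M T 1 (space M - S)"
    using sets.sets_into_space[OF sets(1)] unfolding preimage_compl by blast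
  then have "ess_subset M ?A (preimage M T 1 (space M - S))"
    by (rule ess_subset_if_subset)
  then have "ess_subset M A' (space M - S)"
    using A' sets(1) by (auto simp: essential_image_def)
  then have "separates M S ?A A'"
    by (simp add: separates_def ess_subset_if_subset Diff_subset)
  with S sets show ?thesis
    using remain_separated_iff_tail_set by blast
qed

lemma tail_set_invariant_if_remain_separated_null:
  assumes image: "\<And>A. A \<in> sets M \<Longrightarrow> essential_image M T A (That A)"
    and null: "\<And>A. A \<in> sets M \<Longrightarrow> remain_separated M T A (That A) \<Longrightarrow> A \<in> null_sets M"
    and S: "tail_set M T S"
  shows "invariant_set M T S"
proof -
  have tail_subset_preimage: "ess_subset M R (preimage M T 1 R)" if R: "tail_set M T R" for R
  proof -
    have "R - preimage M T 1 R \<in> sets M"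
      using R by (auto simp: tail_set_def)
    then have "R - preimage M T 1 R \<in> null_sets M"
      using null image remain_separated_tail_set_diff_preimage[OF R] by blast
    then show ?thesis
      by (simp add: ess_subset_def)
  qed
  have S_sets: "S \<in> sets M"
    using S by (simp add: tail_set_def)
  have "ess_subset M (space M - S) (space M - preimage M T 1 S)"
    using tail_subset_preimage[OF tail_set_compl[OF S]] unfolding preimage_compl .
  then have "ess_subset M (preimage M T 1 S) S"
    using S_sets by (simp add: ess_subset_compl_iff)
  with tail_subset_preimage[OF S] S_sets show ?thesis
    by (simp add: invariant_set_def ess_eq_iff_ess_subset)
qed

end

subsection \<open>Null-preserving maps\<close>

locale null_preserving_system =
  fixes M :: "'a measure" and T :: "'a \<Rightarrow> 'a"
  assumes null_preserving: "null_preserving M T"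

sublocale null_preserving_system \<subseteq> measurable_system
  using null_preserving by unfold_locales (simp add: null_preserving_def)

context null_preserving_system
begin

lemma null_sets_preimage: "N \<in> null_sets M \<Longrightarrow> preimage M T 1 N \<in> null_sets M"
  using null_preserving by (simp add: null_preserving_def null_sets_def)

lemma ess_subset_preimage:
  assumes "ess_subset M A B"
  shows "ess_subset M (preimage M T 1 A) (preimage M T 1 B)"
proof -
  have "preimage M T 1 (A - B) = preimage M T 1 A - preimage M T 1 B"
    by (auto simp: preimage_def)
  then show ?thesis
    using null_sets_preimage[of "A - B"] assms by (simp add: ess_subset_def)
qed

lemma ess_eq_preimage:
  assumes "ess_eq M A B" "A \<in> sets M" "B \<in> sets M"
  shows "ess_eq M (preimage M T 1 A) (preimage M T 1 B)"
  using assms ess_subset_preimage by (simp add: ess_eq_iff_ess_subset)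

lemma invariant_set_imp_tail_set:
  assumes "invariant_set M T A"
  shows "tail_set M T A"
proof -
  have A: "A \<in> sets M" and inv: "ess_eq M A (preimage M T 1 A)"
    using assms by (simp_all add: invariant_set_def)
  have "ess_eq M A (preimage M T n A)" for n
  proof (induction n)
    case 0
    show ?case
      using sets.sets_into_space[OF A] by (simp add: ess_eq_def preimage_def Int_absorb2)
  next
    case (Suc n)
    have "ess_eq M (preimage M T 1 A) (preimage M T (Suc n) A)"
      using ess_eq_preimage[OF Suc.IH] A preimage_add[of n 1 A] by simp
    with inv show ?case
      using ess_eq_trans A sets_preimage by blast
  qed
  then have "remain_separated M T A (space M - A)"
    using A by (auto simp: remain_separated_iff_separates separates_from_compl_iff_ess_eq)
  with A show ?thesis
    by (simp add: tail_set_iff_remain_separated_compl)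
qed

lemma null_set_imp_invariant_set:
  assumes "A \<in> null_sets M"
  shows "invariant_set M T A"
proof -
  have "sym_diff A (preimage M T 1 A) \<in> null_sets M"
    using assms null_sets_preimage[OF assms] by auto
  with assms show ?thesis
    by (auto simp: invariant_set_def ess_eq_def)
qed

lemma trivial_imp_invariant_set:
  assumes A: "A \<in> sets M" and trivial: "emeasure M A = 0 \<or> emeasure M (space M - A) = 0"
  shows "invariant_set M T A"
proof -
  have "invariant_set M T A \<or> invariant_set M T (space M - A)"
    using A trivial null_set_imp_invariant_set by (auto simp: null_sets_def)
  then show ?thesis
    using invariant_set_compl[of "space M - A"] A
    by (auto simp: double_diff sets.sets_into_space)
qed

lemma exact_iff_ergodic_and_tail_sets_invariant:
  "exact M T \<longleftrightarrow> ergodic M T \<and> (\<forall>A. tail_set M T A \<longrightarrow> invariant_set M T A)"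
proof -
  have "A \<in> sets M" if "tail_set M T A" for A
    using that by (simp add: tail_set_def)
  then show ?thesis
    using trivial_imp_invariant_set invariant_set_imp_tail_set
    unfolding exact_def ergodic_def by blast
qed

lemma ess_subset_preimage_iff_essential_image:
  assumes "essential_image M T A A'" "A \<in> sets M" "B \<in> sets M"
  shows "ess_subset M A (preimage M T 1 B) \<longleftrightarrow> ess_subset M A' B"
proof
  assume "ess_subset M A' B"
  then have "ess_subset M (preimage M T 1 A') (preimage M T 1 B)"
    by (rule ess_subset_preimage)
  with assms show "ess_subset M A (preimage M T 1 B)"
    unfolding essential_image_def by (blast intro: ess_subset_trans sets_preimage)
qed (use assms in \<open>auto simp: essential_image_def\<close>)

lemma null_set_essential_image_iff:
  assumes "essential_image M T A A'" "A \<in> sets M"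
  shows "A' \<in> null_sets M \<longleftrightarrow> A \<in> null_sets M"
  using ess_subset_preimage_iff_essential_image[OF assms, of "{}"]
  by (simp add: ess_subset_def preimage_def)

lemma null_set_if_invariant_set_separates:
  assumes A': "essential_image M T A A'" and A: "A \<in> sets M"
    and S: "invariant_set M T S" and sep: "separates M S A A'"
  shows "A \<in> null_sets M"
proof -
  have S_sets: "S \<in> sets M" and S_preimage: "ess_subset M S (preimage M T 1 S)"
    using S by (auto simp: invariant_set_def ess_eq_iff_ess_subset)
  have "ess_subset M A S" and disjoint: "ess_subset M A' (space M - S)"
    using sep by (simp_all add: separates_def)
  then have "ess_subset M A (preimage M T 1 S)"
    using S_preimage A S_sets sets_preimage by (blast intro: ess_subset_trans)
  then have "ess_subset M A' S"
    using ess_subset_preimage_iff_essential_image[OF A' A S_sets] by blast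
  then have "A' \<in> null_sets M"
    using disjoint A' by (intro null_set_if_ess_subset_compl) (auto simp: essential_image_def)
  with A' A show ?thesis
    by (simp add: null_set_essential_image_iff)
qed

lemma remain_separated_essential_image_iff_null_set:
  assumes inv: "\<And>S. tail_set M T S \<Longrightarrow> invariant_set M T S"
    and A: "A \<in> sets M" and A': "essential_image M T A A'"
  shows "remain_separated M T A A' \<longleftrightarrow> A \<in> null_sets M"
proof
  have "A' \<in> sets M"
    using A' by (simp add: essential_image_def)
  moreover assume "remain_separated M T A A'"
  ultimately obtain S where "tail_set M T S" "separates M S A A'"
    using A by (auto simp: remain_separated_iff_tail_set)
  with inv show "A \<in> null_sets M"
    using null_set_if_invariant_set_separates[OF A' A] by blast
qed (use A' remain_separated_null_set in \<open>auto simp: essential_image_def\<close>)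

end

theorem theorem5p5:
  fixes M :: "'a measure" and T :: "'a \<Rightarrow> 'a" and That :: "'a set \<Rightarrow> 'a set"
  assumes "sigma_finite_measure M"
    and "null_preserving M T"
    and "\<And>A. A \<in> sets M \<Longrightarrow> essential_image M T A (That A)"
  shows "((\<forall>A. tail_set M T A \<longrightarrow> invariant_set M T A) \<longleftrightarrow>
          (\<forall>A\<in>sets M. remain_separated M T A (That A) \<longleftrightarrow> ess_eq M A {})) \<and>
         (exact M T \<longleftrightarrow>
            ergodic M T \<and>
            (\<forall>A\<in>sets M. remain_separated M T A (That A) \<longleftrightarrow> ess_eq M A {}))"
proof -
  interpret null_preserving_system M T
    using assms(2) by unfold_locales
  have "(\<forall>A. tail_set M T A \<longrightarrow> invariant_set M T A) \<longleftrightarrow>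
      (\<forall>A\<in>sets M. remain_separated M T A (That A) \<longleftrightarrow> ess_eq M A {})"
    unfolding ess_eq_empty_iff
    using remain_separated_essential_image_iff_null_set[OF _ _ assms(3)]
      tail_set_invariant_if_remain_separated_null[OF assms(3)]
    by blast
  then show ?thesis
    by (simp add: exact_iff_ergodic_and_tail_sets_invariant)
qed

end
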